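(* For every integer $n\ge 4$, the group $M_{2^n}=\langle a,b:\ a^{2^{n-1}}=b^2=1,\ bab=a^{1+2^{n-2}}\rangle$ is not a Schur group.
   Context: Let $D$ be a finite group with identity $e$. For $X\subseteq D$ put $\underline{X}=\sum_{x\in X}x\in\mathbb{Z}D$. A subring $\mathcal{A}$ of the group ring $\mathbb{Z}D$ is an S-ring (Schur ring) over $D$ if there is a partition $\mathcal{S}=\mathcal{S}(\mathcal{A})$ of $D$ such that $\{e\}\in\mathcal{S}$; $X\in\mathcal{S}$ implies $X^{-1}\in\mathcal{S}$; and $\mathcal{A}$ is the $\mathbb{Z}$-span of $\{\underline{X}: X\in\mathcal{S}\}$. An S-ring $\mathcal{A}$ over $D$ is schurian if there is a subgroup $G\le\mathrm{Sym}(D)$ containing all right translations of $D$ such that $\mathcal{S}(\mathcal{A})$ is the set of orbits on $D$ of the stabilizer $G_e$. A finite group $D$ is a Schur group if every S-ring over $D$ is schurian. *)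

theory Defs
  imports "HOL-Algebra.Group_Action" "HOL-Algebra.Subrings" "HOL-Library.Disjoint_Sets" "HOL-Library.Indicator_Function"
begin

section \<open>Groups given by generators and relations\<close>

text \<open>A word is a list of letters; the letter \<open>(g, True)\<close> stands for the generator \<open>g\<close> and
  \<open>(g, False)\<close> for its formal inverse.  All elements of the type \<open>'g\<close> are generators.
  A pair \<open>(u, v)\<close> in \<open>R\<close> is the relation \<open>u = v\<close>.\<close>

type_synonym 'g gword = "('g \<times> bool) list"

inductive word_cong :: "('g gword \<times> 'g gword) set \<Rightarrow> 'g gword \<Rightarrow> 'g gword \<Rightarrow> bool"
  for R where
  wc_refl: "word_cong R u u"
| wc_sym: "word_cong R u v \<Longrightarrow> word_cong R v u"
| wc_trans: "word_cong R u v \<Longrightarrow> word_cong R v w \<Longrightarrow> word_cong R u w"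
| wc_append: "word_cong R u u' \<Longrightarrow> word_cong R v v' \<Longrightarrow> word_cong R (u @ v) (u' @ v')"
| wc_cancel: "word_cong R [(g, s), (g, \<not> s)] []"
| wc_rel: "(u, v) \<in> R \<Longrightarrow> word_cong R u v"

definition word_class :: "('g gword \<times> 'g gword) set \<Rightarrow> 'g gword \<Rightarrow> 'g gword set" where
  "word_class R u = {w. word_cong R u w}"

definition presented_group :: "('g gword \<times> 'g gword) set \<Rightarrow> 'g gword set monoid" where
  "presented_group R =
    \<lparr>carrier = range (word_class R),
     mult = (\<lambda>X Y. {w. \<exists>u\<in>X. \<exists>v\<in>Y. word_cong R (u @ v) w}),
     one = word_class R []\<rparr>"

lemma word_class_eq_iff: "word_class R u = word_class R v \<longleftrightarrow> word_cong R u v"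
  unfolding word_class_def by (blast intro: wc_refl wc_sym wc_trans)

lemma presented_group_mult:
  "word_class R u \<otimes>\<^bsub>presented_group R\<^esub> word_class R v = word_class R (u @ v)"
proof -
  have "(\<exists>u'. word_cong R u u' \<and> (\<exists>v'. word_cong R v v' \<and> word_cong R (u' @ v') w))
      \<longleftrightarrow> word_cong R (u @ v) w" for w
    by (blast intro: wc_refl wc_sym wc_trans wc_append)
  then show ?thesis
    by (simp add: presented_group_def word_class_def)
qed

lemma wc_inverse: "word_cong R (rev (map (\<lambda>(g, s). (g, \<not> s)) w) @ w) []"
proof (induction w)
  case Nil
  show ?case by (simp add: wc_refl)
next
  case (Cons x w)
  obtain g s where x: "x = (g, s)" by (cases x)
  let ?i = "rev (map (\<lambda>(g, s). (g, \<not> s)) w)"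
  have "word_cong R [(g, \<not> s), (g, s)] []"
    using wc_cancel[of R g "\<not> s"] by simp
  from wc_append[OF wc_append[OF wc_refl[of R ?i] this] wc_refl[of R w]]
  have "word_cong R (?i @ [(g, \<not> s), (g, s)] @ w) (?i @ w)" by simp
  then show ?case using Cons.IH x by (auto intro: wc_trans)
qed

lemma presented_group_one: "\<one>\<^bsub>presented_group R\<^esub> = word_class R []"
  by (simp add: presented_group_def)

lemma presented_group_carrier: "carrier (presented_group R) = range (word_class R)"
  by (simp add: presented_group_def)

lemma group_presented_group: "group (presented_group R)"
proof (rule groupI)
  fix X assume "X \<in> carrier (presented_group R)"
  then obtain w where X: "X = word_class R w" by (auto simp: presented_group_carrier)
  let ?Y = "word_class R (rev (map (\<lambda>(g, s). (g, \<not> s)) w))"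
  have "?Y \<otimes>\<^bsub>presented_group R\<^esub> X = \<one>\<^bsub>presented_group R\<^esub>"
    by (simp add: X presented_group_mult presented_group_one word_class_eq_iff wc_inverse)
  moreover have "?Y \<in> carrier (presented_group R)"
    by (simp add: presented_group_carrier)
  ultimately show "\<exists>Y\<in>carrier (presented_group R).
      Y \<otimes>\<^bsub>presented_group R\<^esub> X = \<one>\<^bsub>presented_group R\<^esub>" by blast
qed (auto simp: presented_group_carrier presented_group_one presented_group_mult)


section \<open>The group \<open>M\<close> of order \<open>2 ^ n\<close>\<close>

datatype gen = GenA | GenB

abbreviation (input) gpow :: "'g \<Rightarrow> nat \<Rightarrow> 'g gword" where
  "gpow g k \<equiv> replicate k (g, True)"

definition modular_relations :: "nat \<Rightarrow> (gen gword \<times> gen gword) set" where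
  "modular_relations n =
    {(gpow GenA (2 ^ (n - 1)), []),
     (gpow GenB 2, []),
     (gpow GenB 1 @ gpow GenA 1 @ gpow GenB 1, gpow GenA (1 + 2 ^ (n - 2)))}"

definition modular_group :: "nat \<Rightarrow> gen gword set monoid" where
  "modular_group n = presented_group (modular_relations n)"

lemma wc_gpow_mod:
  assumes "word_cong R (gpow g N) []"
  shows "word_cong R (gpow g i) (gpow g (i mod N))"
proof (induction i rule: less_induct)
  case (less i)
  show ?case
  proof (cases "N = 0 \<or> i < N")
    case True
    then show ?thesis by (auto simp: wc_refl)
  next
    case False
    then have "gpow g i = gpow g N @ gpow g (i - N)"
      by (simp flip: replicate_add)
    then have "word_cong R (gpow g i) (gpow g (i - N))"
      using wc_append[OF assms wc_refl[of R "gpow g (i - N)"]] by simp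
    moreover have "word_cong R (gpow g (i - N)) (gpow g (i mod N))"
      using False less.IH[of "i - N"] by (simp add: le_mod_geq)
    ultimately show ?thesis by (rule wc_trans)
  qed
qed

lemma modular_normal_form:
  "\<exists>i j. word_cong (modular_relations n) w (gpow GenA i @ gpow GenB j)"
proof -
  define k :: nat where "k = 1 + 2 ^ (n - 2)"
  define N :: nat where "N = 2 ^ (n - 1)"
  let ?R = "modular_relations n"
  let ?a = "[(GenA, True)]" and ?b = "[(GenB, True)]"
  have aN: "word_cong ?R (gpow GenA N) []"
    and bb: "word_cong ?R (?b @ ?b) []"
    and bab: "word_cong ?R (?b @ ?a @ ?b) (gpow GenA k)"
    by (auto intro!: wc_rel simp: modular_relations_def N_def k_def numeral_2_eq_2)
  have ba: "word_cong ?R (?b @ ?a) (gpow GenA k @ ?b)"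
  proof -
    have "word_cong ?R (?b @ ?a @ ?b @ ?b) (?b @ ?a)"
      using wc_append[OF wc_refl[of ?R "?b @ ?a"] bb] by simp
    moreover have "word_cong ?R (?b @ ?a @ ?b @ ?b) (gpow GenA k @ ?b)"
      using wc_append[OF bab wc_refl[of ?R ?b]] by simp
    ultimately show ?thesis by (blast intro: wc_sym wc_trans)
  qed
  have bai: "word_cong ?R (?b @ gpow GenA i) (gpow GenA (k * i) @ ?b)" for i
  proof (induction i)
    case 0
    show ?case by (simp add: wc_refl)
  next
    case (Suc i)
    have "word_cong ?R (?b @ ?a @ gpow GenA i) (gpow GenA k @ ?b @ gpow GenA i)"
      using wc_append[OF ba wc_refl[of ?R "gpow GenA i"]] by simp
    moreover have "word_cong ?R (gpow GenA k @ ?b @ gpow GenA i)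
        (gpow GenA k @ gpow GenA (k * i) @ ?b)"
      by (rule wc_append[OF wc_refl Suc.IH])
    ultimately show ?case
      by (auto simp: replicate_add intro: wc_trans)
  qed
  have ainv: "word_cong ?R [(GenA, False)] (gpow GenA (N - 1))"
  proof -
    have "gpow GenA N = ?a @ gpow GenA (N - 1)"
      by (simp add: N_def flip: replicate_Suc)
    then have "word_cong ?R ([(GenA, False)] @ ?a @ gpow GenA (N - 1)) [(GenA, False)]"
      using wc_append[OF wc_refl[of ?R "[(GenA, False)]"] aN] by simp
    moreover have "word_cong ?R ([(GenA, False)] @ ?a @ gpow GenA (N - 1)) (gpow GenA (N - 1))"
      using wc_append[OF wc_cancel[of ?R GenA False] wc_refl[of ?R "gpow GenA (N - 1)"]] by simp
    ultimately show ?thesis by (blast intro: wc_sym wc_trans)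
  qed
  have binv: "word_cong ?R [(GenB, False)] ?b"
  proof -
    have "word_cong ?R ([(GenB, False)] @ ?b @ ?b) [(GenB, False)]"
      using wc_append[OF wc_refl[of ?R "[(GenB, False)]"] bb] by simp
    moreover have "word_cong ?R ([(GenB, False)] @ ?b @ ?b) ?b"
      using wc_append[OF wc_cancel[of ?R GenB False] wc_refl[of ?R ?b]] by simp
    ultimately show ?thesis by (blast intro: wc_sym wc_trans)
  qed
  show ?thesis
  proof (induction w)
    case Nil
    show ?case by (rule exI[of _ 0], rule exI[of _ 0]) (simp add: wc_refl)
  next
    case (Cons x w)
    then obtain i j where ij: "word_cong ?R w (gpow GenA i @ gpow GenB j)" by blast
    have step: "word_cong ?R (x # w) (u @ gpow GenA i @ gpow GenB j)"
      if "word_cong ?R [x] u" for u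
      using wc_append[OF that ij] by simp
    obtain g s where x: "x = (g, s)" by (cases x)
    show ?case
    proof (cases g)
      case GenA
      have "word_cong ?R [x] (gpow GenA (if s then 1 else N - 1))"
        using ainv wc_refl[of ?R ?a] x GenA by (cases s) simp_all
      then obtain m where "word_cong ?R [x] (gpow GenA m)" by blast
      from step[OF this] show ?thesis
        by (intro exI[of _ "m + i"] exI[of _ j]) (simp add: replicate_add)
    next
      case GenB
      have "word_cong ?R [x] ?b"
        using binv wc_refl[of ?R ?b] x GenB by (cases s) auto
      from step[OF this]
      have "word_cong ?R (x # w) (?b @ gpow GenA i @ gpow GenB j)" .
      moreover have "word_cong ?R (?b @ gpow GenA i @ gpow GenB j)
          (gpow GenA (k * i) @ ?b @ gpow GenB j)"
        using wc_append[OF bai wc_refl[of ?R "gpow GenB j"]] by simp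
      ultimately have "word_cong ?R (x # w) (gpow GenA (k * i) @ ?b @ gpow GenB j)"
        by (rule wc_trans)
      then show ?thesis
        by (intro exI[of _ "k * i"] exI[of _ "Suc j"]) simp
    qed
  qed
qed

lemma finite_modular_group: "finite (carrier (modular_group n))"
proof -
  define N :: nat where "N = 2 ^ (n - 1)"
  let ?R = "modular_relations n"
  have aN: "word_cong ?R (gpow GenA N) []" and bb: "word_cong ?R (gpow GenB 2) []"
    by (auto intro!: wc_rel simp: modular_relations_def N_def)
  have "word_class ?R w \<in> (\<lambda>(i, j). word_class ?R (gpow GenA i @ gpow GenB j)) ` ({..<N} \<times> {..<2})"
    for w
  proof -
    obtain i j where "word_cong ?R w (gpow GenA i @ gpow GenB j)"
      using modular_normal_form by blast
    moreover have "word_cong ?R (gpow GenA i @ gpow GenB j)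
        (gpow GenA (i mod N) @ gpow GenB (j mod 2))"
      by (intro wc_append wc_gpow_mod aN bb)
    ultimately have "word_class ?R w = word_class ?R (gpow GenA (i mod N) @ gpow GenB (j mod 2))"
      unfolding word_class_eq_iff by (rule wc_trans)
    moreover have "(i mod N, j mod 2) \<in> {..<N} \<times> {..<2}" by (simp add: N_def)
    ultimately show ?thesis by (metis (mono_tags, lifting) case_prod_conv image_eqI)
  qed
  then have "carrier (modular_group n)
      \<subseteq> (\<lambda>(i, j). word_class ?R (gpow GenA i @ gpow GenB j)) ` ({..<N} \<times> {..<2})"
    by (auto simp: modular_group_def presented_group_carrier)
  then show ?thesis by (rule finite_subset) simp
qed

lemma group_modular_group: "group (modular_group n)"
  unfolding modular_group_def by (rule group_presented_group)


section \<open>S-rings and Schur groups\<close>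

text \<open>The notions below are meant for a finite group \<open>D\<close>.  Elements of the integral group ring
  are integer-valued functions vanishing outside \<open>carrier D\<close>, so that \<open>indicator X\<close> is the
  formal sum of the elements of \<open>X\<close>; multiplication is convolution.\<close>

definition group_ring :: "('a, 'm) monoid_scheme \<Rightarrow> ('a \<Rightarrow> int) ring" where
  "group_ring D =
    \<lparr>carrier = {f. \<forall>x. x \<notin> carrier D \<longrightarrow> f x = 0},
     mult = (\<lambda>f g x. \<Sum>(y, z)\<in>{(y, z) \<in> carrier D \<times> carrier D. y \<otimes>\<^bsub>D\<^esub> z = x}. f y * g z),
     one = indicator {\<one>\<^bsub>D\<^esub>},
     zero = (\<lambda>_. 0),
     add = (\<lambda>f g x. f x + g x)\<rparr>"

definition int_span :: "'a set set \<Rightarrow> ('a \<Rightarrow> int) set" where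
  "int_span S = {f. \<exists>c :: 'a set \<Rightarrow> int. f = (\<lambda>x. \<Sum>X\<in>S. c X * indicator X x)}"

text \<open>\<open>basic_partition D A S\<close> says that \<open>S\<close> is the partition $\mathcal S(A)$ belonging to the
  S-ring \<open>A\<close>; it is determined by \<open>A\<close>, see \<open>basic_partition_unique\<close>.\<close>

definition basic_partition ::
    "('a, 'm) monoid_scheme \<Rightarrow> ('a \<Rightarrow> int) set \<Rightarrow> 'a set set \<Rightarrow> bool" where
  "basic_partition D A S \<longleftrightarrow>
    partition_on (carrier D) S \<and>
    {\<one>\<^bsub>D\<^esub>} \<in> S \<and>
    (\<forall>X\<in>S. (\<lambda>x. inv\<^bsub>D\<^esub> x) ` X \<in> S) \<and>
    A = int_span S"

definition s_ring :: "('a, 'm) monoid_scheme \<Rightarrow> ('a \<Rightarrow> int) set \<Rightarrow> bool" where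
  "s_ring D A \<longleftrightarrow> subring A (group_ring D) \<and> (\<exists>S. basic_partition D A S)"

text \<open>The symmetric group on \<open>carrier D\<close> is \<open>BijGroup (carrier D)\<close>; its elements are the
  bijections of \<open>carrier D\<close> extended by \<open>undefined\<close>, hence the restricted abstraction.\<close>

definition right_translation :: "('a, 'm) monoid_scheme \<Rightarrow> 'a \<Rightarrow> 'a \<Rightarrow> 'a" where
  "right_translation D g = (\<lambda>x\<in>carrier D. x \<otimes>\<^bsub>D\<^esub> g)"

definition perm_group :: "'a set \<Rightarrow> ('a \<Rightarrow> 'a) set \<Rightarrow> ('a \<Rightarrow> 'a) monoid" where
  "perm_group E G = (BijGroup E)\<lparr>carrier := G\<rparr>"

definition point_stabilizer :: "'a set \<Rightarrow> ('a \<Rightarrow> 'a) set \<Rightarrow> 'a \<Rightarrow> ('a \<Rightarrow> 'a) set" where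
  "point_stabilizer E G x = stabilizer (perm_group E G) (\<lambda>g. g) x"

definition perm_orbits :: "'a set \<Rightarrow> ('a \<Rightarrow> 'a) set \<Rightarrow> 'a set set" where
  "perm_orbits E G = orbits (perm_group E G) E (\<lambda>g. g)"

definition schurian :: "('a, 'm) monoid_scheme \<Rightarrow> ('a \<Rightarrow> int) set \<Rightarrow> bool" where
  "schurian D A \<longleftrightarrow>
    (\<exists>G. subgroup G (BijGroup (carrier D)) \<and>
      right_translation D ` carrier D \<subseteq> G \<and>
      basic_partition D A (perm_orbits (carrier D) (point_stabilizer (carrier D) G \<one>\<^bsub>D\<^esub>)))"

definition schur_group :: "('a, 'm) monoid_scheme \<Rightarrow> bool" where
  "schur_group D \<longleftrightarrow> (\<forall>A. s_ring D A \<longrightarrow> schurian D A)"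

lemma basic_partition_refines:
  assumes fin: "finite (carrier D)"
    and S: "basic_partition D A S" and S': "basic_partition D A S'"
    and X: "X \<in> S" and X': "X' \<in> S'" and x: "x \<in> X" "x \<in> X'"
  shows "X \<subseteq> X'"
proof
  fix y assume y: "y \<in> X"
  have part: "partition_on (carrier D) S" "partition_on (carrier D) S'"
    using S S' by (auto simp: basic_partition_def)
  then have finS: "finite S" "finite S'"
    using fin by (auto intro: finite_elements)
  have "(indicator X' :: 'a \<Rightarrow> int) = (\<lambda>z. \<Sum>Y\<in>S'. (if Y = X' then 1 else 0) * indicator Y z)"
    using X' finS by (auto simp: if_distrib[of "\<lambda>c. c * _"] cong: if_cong)
  then have "(indicator X' :: 'a \<Rightarrow> int) \<in> int_span S'"
    unfolding int_span_def by (intro CollectI exI[of _ "\<lambda>Y. if Y = X' then 1 else 0"]) simp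
  then have "(indicator X' :: 'a \<Rightarrow> int) \<in> int_span S"
    using S S' by (simp add: basic_partition_def)
  then obtain c :: "'a set \<Rightarrow> int"
    where c: "indicator X' = (\<lambda>z. \<Sum>Y\<in>S. c Y * indicator Y z)"
    by (auto simp: int_span_def)
  have "indicator Y x = (indicator Y y :: int)" if "Y \<in> S" for Y
    using that X x y part(1) by (auto simp: partition_on_def disjoint_def indicator_def)
  then have "(indicator X' x :: int) = indicator X' y"
    unfolding c by simp
  then show "y \<in> X'" using x by (auto simp: indicator_def split: if_splits)
qed

lemma basic_partition_unique:
  assumes fin: "finite (carrier D)"
    and S: "basic_partition D A S" and S': "basic_partition D A S'"
  shows "S = S'"
proof -
  have "P \<subseteq> Q" if P: "basic_partition D A P" and Q: "basic_partition D A Q" for P Q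
  proof
    fix X assume X: "X \<in> P"
    then obtain x where x: "x \<in> X" "x \<in> carrier D"
      using P unfolding basic_partition_def partition_on_def by (metis UnionI ex_in_conv)
    then obtain Y where Y: "Y \<in> Q" "x \<in> Y"
      using Q by (auto simp: basic_partition_def partition_on_def)
    have "X = Y"
      using basic_partition_refines[OF fin P Q X Y(1) x(1) Y(2)]
        basic_partition_refines[OF fin Q P Y(1) X Y(2) x(1)] by blast
    then show "X \<in> Q" using Y by simp
  qed
  then show ?thesis using S S' by blast
qed

end

theory Submission
  imports Defs "HOL-Library.Multiset"
begin

text \<open>An S-ring is a colouring of the group whose colour classes have constant structure constants;
  if it were schurian, any two points of one colour would be exchanged by a bijection that fixes the
  identity and preserves the colours of all quotients \<open>x y\<^sup>-\<^sup>1\<close>.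

  Let \<open>m = 2 ^ (n - 2)\<close>, let \<open>c = a ^ m\<close> and \<open>E = {1, b, c, c b}\<close>; this is a normal subgroup with
  cyclic quotient of order \<open>m\<close>, and \<open>a\<close> swaps \<open>b\<close> and \<open>c b\<close> by conjugation.
  For \<open>n \<ge> 5\<close> the classes inside \<open>a ^ r E\<close> are the cosets of a subgroup \<open>K r\<close> of \<open>E\<close>, where
  \<open>K 0 = 1\<close>, \<open>K r = {1, c}\<close> for even \<open>r \<noteq> 0\<close>, \<open>K 1 = {1, b}\<close>, \<open>K (- 1) = {1, c b}\<close>, and \<open>K r = E\<close>
  for the other odd \<open>r\<close>.  A colour preserving bijection fixing \<open>1\<close> multiplies \<open>a ^ r\<close> by an element
  of \<open>E\<close>; the quotients \<open>a\<close> and \<open>a ^ 2\<close> determine these elements step by step and force \<open>a ^ 4\<close>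
  to be fixed, although \<open>a ^ 4\<close> and \<open>c a ^ 4\<close> have the same colour.  For \<open>n = 4\<close> there is no such
  room, and one uses the classes \<open>{1}\<close>, \<open>{a ^ 4}\<close>, \<open>{a ^ 2, a ^ 6}\<close>, \<open>{b, a ^ 2 b, a ^ 4 b, a ^ 6 b}\<close>,
  \<open>{a, a ^ 7, a b, a ^ 3 b}\<close> and \<open>{a ^ 3, a ^ 5, a ^ 5 b, a ^ 7 b}\<close>, for which \<open>b\<close> cannot be moved
  to \<open>a ^ 2 b\<close>.\<close>

section \<open>S-rings from colourings\<close>

definition fibres :: "('a, 'm) monoid_scheme \<Rightarrow> ('a \<Rightarrow> 'c) \<Rightarrow> 'a set set" where
  "fibres D col = (\<lambda>x. {y \<in> carrier D. col y = col x}) ` carrier D"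

lemma partition_on_fibres: "partition_on (carrier D) (fibres D col)"
  by (auto simp: partition_on_def fibres_def disjoint_def)

text \<open>Turns membership in the span into a pointwise condition, for which closure is easy to
  check; the coefficient of a class is the value at a chosen element of it.\<close>

lemma int_span_fibres:
  assumes fin: "finite (carrier D)"
  shows "int_span (fibres D col) =
    {f. (\<forall>x. x \<notin> carrier D \<longrightarrow> f x = 0) \<and>
        (\<forall>x\<in>carrier D. \<forall>y\<in>carrier D. col x = col y \<longrightarrow> f x = f y)}" (is "_ = ?R")
proof (intro equalityI subsetI)
  fix f assume "f \<in> int_span (fibres D col)"
  then obtain c :: "'a set \<Rightarrow> int"
    where f: "f = (\<lambda>x. \<Sum>X\<in>fibres D col. c X * indicator X x)"
    by (auto simp: int_span_def)
  have "f x = 0" if "x \<notin> carrier D" for x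
    unfolding f using that by (intro sum.neutral) (auto simp: fibres_def indicator_def)
  moreover have "f x = f y" if "x \<in> carrier D" "y \<in> carrier D" "col x = col y" for x y
    unfolding f using that by (intro sum.cong) (auto simp: fibres_def indicator_def)
  ultimately show "f \<in> ?R" by blast
next
  fix f assume f: "f \<in> ?R"
  let ?c = "\<lambda>X. f (SOME x. x \<in> X)"
  have finS: "finite (fibres D col)"
    using fin by (simp add: fibres_def)
  have "f x = (\<Sum>X\<in>fibres D col. ?c X * indicator X x)" for x
  proof (cases "x \<in> carrier D")
    case False
    then have "(\<Sum>X\<in>fibres D col. ?c X * indicator X x) = 0"
      by (intro sum.neutral) (auto simp: fibres_def indicator_def)
    with False f show ?thesis by simp
  next
    case True
    let ?X = "{y \<in> carrier D. col y = col x}"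
    have X: "?X \<in> fibres D col" using True by (auto simp: fibres_def)
    have "(SOME y. y \<in> ?X) \<in> ?X"
      by (rule someI[of "\<lambda>y. y \<in> ?X" x]) (use True in simp)
    then have c: "?c ?X = f x" using f True by blast
    have "?c Y * indicator Y x = (if Y = ?X then f x else 0)"
      if "Y \<in> fibres D col" for Y
    proof (cases "Y = ?X")
      case True
      then show ?thesis using c \<open>x \<in> carrier D\<close> by simp
    next
      case False
      then have "x \<notin> Y" using that by (auto simp: fibres_def)
      then show ?thesis using False by simp
    qed
    then have "(\<Sum>Y\<in>fibres D col. ?c Y * indicator Y x)
        = (\<Sum>Y\<in>fibres D col. if Y = ?X then f x else 0)"
      by (intro sum.cong) auto
    also have "\<dots> = f x" using X finS by simp
    finally show ?thesis by simp
  qed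
  then have "f = (\<lambda>x. \<Sum>X\<in>fibres D col. ?c X * indicator X x)" by (rule ext)
  then show "f \<in> int_span (fibres D col)" unfolding int_span_def by (intro CollectI exI)
qed

section \<open>Convolution and negation in the group ring\<close>

lemma group_ring_mult_eq_sum:
  fixes D (structure)
  assumes "group D" and "finite (carrier D)" and "x \<in> carrier D"
  shows "(f \<otimes>\<^bsub>group_ring D\<^esub> g) x = (\<Sum>z\<in>carrier D. f (x \<otimes>\<^bsub>D\<^esub> inv\<^bsub>D\<^esub> z) * g z)"
proof -
  interpret group D by fact
  have "(\<Sum>(y, z)\<in>{(y, z) \<in> carrier D \<times> carrier D. y \<otimes> z = x}. f y * g z)
      = (\<Sum>z\<in>carrier D. f (x \<otimes> inv z) * g z)"
    by (rule sum.reindex_bij_witness[of _ "\<lambda>z. (x \<otimes> inv z, z)" snd])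
       (use assms(3) in \<open>auto simp: m_assoc\<close>)
  then show ?thesis by (simp add: group_ring_def)
qed

text \<open>Computed straight from the definite description behind \<open>m_inv\<close>, so no ring
  axioms for \<open>group_ring D\<close> have to be established first.\<close>

lemma a_inv_group_ring:
  assumes "f \<in> carrier (group_ring D)"
  shows "inv\<^bsub>add_monoid (group_ring D)\<^esub> f = (\<lambda>x. - f x)"
  unfolding m_inv_def
proof (rule the_equality)
  fix g assume "g \<in> carrier (add_monoid (group_ring D)) \<and>
    f \<otimes>\<^bsub>add_monoid (group_ring D)\<^esub> g = \<one>\<^bsub>add_monoid (group_ring D)\<^esub> \<and>
    g \<otimes>\<^bsub>add_monoid (group_ring D)\<^esub> f = \<one>\<^bsub>add_monoid (group_ring D)\<^esub>"
  then have "(\<lambda>x. f x + g x) = (\<lambda>_. 0)" by (simp add: group_ring_def)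
  then have "f x + g x = 0" for x by (rule fun_cong)
  then show "g = (\<lambda>x. - f x)" by (intro ext) (metis minus_unique)
qed (use assms in \<open>auto simp: group_ring_def\<close>)

text \<open>The multiset condition says that the number of \<open>z\<close> with \<open>x z\<^sup>-\<^sup>1\<close> and \<open>z\<close> of given colours
  depends only on the colour of \<open>x\<close>.\<close>

definition schur_colouring :: "('a, 'm) monoid_scheme \<Rightarrow> ('a \<Rightarrow> 'c) \<Rightarrow> bool" where
  "schur_colouring D col \<longleftrightarrow>
    (\<forall>x\<in>carrier D. col x = col \<one>\<^bsub>D\<^esub> \<longrightarrow> x = \<one>\<^bsub>D\<^esub>) \<and>
    (\<forall>x\<in>carrier D. \<forall>y\<in>carrier D. col x = col y \<longrightarrow>
      col (inv\<^bsub>D\<^esub> x) = col (inv\<^bsub>D\<^esub> y) \<and>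
      image_mset (\<lambda>z. (col (x \<otimes>\<^bsub>D\<^esub> inv\<^bsub>D\<^esub> z), col z)) (mset_set (carrier D)) =
      image_mset (\<lambda>z. (col (y \<otimes>\<^bsub>D\<^esub> inv\<^bsub>D\<^esub> z), col z)) (mset_set (carrier D)))"

lemma basic_partition_fibres:
  fixes D (structure)
  assumes "group D" and col: "schur_colouring D col"
  shows "basic_partition D (int_span (fibres D col)) (fibres D col)"
proof -
  interpret group D by fact
  have one: "col x = col \<one> \<Longrightarrow> x = \<one>" if "x \<in> carrier D" for x
    using col that unfolding schur_colouring_def by blast
  have inv: "col (inv x) = col (inv y)" if "x \<in> carrier D" "y \<in> carrier D" "col x = col y" for x y
    using col that unfolding schur_colouring_def by blast
  have "{\<one>} = {y \<in> carrier D. col y = col \<one>}" by (auto dest: one)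
  then have "{\<one>} \<in> fibres D col" by (auto simp: fibres_def)
  moreover have "(\<lambda>x. inv x) ` X \<in> fibres D col" if "X \<in> fibres D col" for X
  proof -
    obtain x where x: "x \<in> carrier D" "X = {y \<in> carrier D. col y = col x}"
      using \<open>X \<in> _\<close> by (auto simp: fibres_def)
    \<comment> \<open>Inversion is an involution respecting equality of colours, so it maps a class
      onto a whole class.\<close>
    have "(\<lambda>x. inv x) ` X = {y \<in> carrier D. col y = col (inv x)}"
    proof (intro equalityI subsetI)
      fix y assume y: "y \<in> {y \<in> carrier D. col y = col (inv x)}"
      then have "inv y \<in> X" using inv[of y "inv x"] x(1) unfolding x(2) by simp
      then show "y \<in> (\<lambda>x. inv x) ` X"
        using y by (intro image_eqI[of _ _ "inv y"]) auto
    next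
      fix y assume "y \<in> (\<lambda>x. inv x) ` X"
      then show "y \<in> {y \<in> carrier D. col y = col (inv x)}"
        unfolding x(2) using inv[OF _ x(1)] by blast
    qed
    then show ?thesis unfolding fibres_def using x(1) by (intro image_eqI[of _ _ "inv x"]) simp_all
  qed
  ultimately show ?thesis
    by (simp add: basic_partition_def partition_on_fibres)
qed

text \<open>Among the closure properties only convolution uses the multiset condition: a product
  evaluated at \<open>x\<close> is a sum over the multiset of colour pairs attached to
  \<open>x\<close>.\<close>

lemma s_ring_fibres:
  fixes D (structure)
  assumes D: "group D" "finite (carrier D)" and col: "schur_colouring D col"
  shows "s_ring D (int_span (fibres D col))"
proof -
  interpret group D by fact
  let ?A = "int_span (fibres D col)"
  note A = int_span_fibres[OF D(2), of col]
  have one: "col x = col \<one> \<longleftrightarrow> x = \<one>" if "x \<in> carrier D" for x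
    using col that unfolding schur_colouring_def by blast
  have const: "f u = f v"
    if "f \<in> ?A" "u \<in> carrier D" "v \<in> carrier D" "col u = col v" for f u v
    using that unfolding A by blast
  have zero: "f u = 0" if "f \<in> ?A" "u \<notin> carrier D" for f u
    using that unfolding A by blast
  have memI: "f \<in> ?A" if "\<And>u. u \<notin> carrier D \<Longrightarrow> f u = 0"
    "\<And>u v. u \<in> carrier D \<Longrightarrow> v \<in> carrier D \<Longrightarrow> col u = col v \<Longrightarrow> f u = f v" for f
    using that unfolding A by blast
  have sub: "?A \<subseteq> carrier (group_ring D)" by (auto simp: A group_ring_def)
  have "indicator {\<one>} \<in> ?A"
    unfolding A indicator_def by clarsimp (metis one one_closed)
  moreover have "f \<otimes>\<^bsub>group_ring D\<^esub> g \<in> ?A" if f: "f \<in> ?A" and g: "g \<in> ?A" for f g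
  proof -
    \<comment> \<open>\<open>F h c\<close> is the value of \<open>h\<close> on the class of colour
      \<open>c\<close>, so that the summands depend on colours alone.\<close>
    define F where "F h c = h (SOME x. x \<in> carrier D \<and> col x = c)" for h :: "'a \<Rightarrow> int" and c
    have F: "h x = F h (col x)" if h: "h \<in> ?A" and x: "x \<in> carrier D" for h x
    proof -
      let ?y = "SOME y. y \<in> carrier D \<and> col y = col x"
      have "?y \<in> carrier D \<and> col ?y = col x"
        by (rule someI[of _ x]) (use x in simp)
      then have "?y \<in> carrier D" "col x = col ?y" by simp_all
      then show ?thesis unfolding F_def by (rule const[OF h x])
    qed
    have prod: "(f \<otimes>\<^bsub>group_ring D\<^esub> g) x =
        sum_mset (image_mset (\<lambda>(p, q). F f p * F g q)
          (image_mset (\<lambda>z. (col (x \<otimes> inv z), col z)) (mset_set (carrier D))))"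
      if "x \<in> carrier D" for x
    proof -
      have "(f \<otimes>\<^bsub>group_ring D\<^esub> g) x
          = (\<Sum>z\<in>carrier D. F f (col (x \<otimes> inv z)) * F g (col z))"
        unfolding group_ring_mult_eq_sum[OF D that]
        using that by (intro sum.cong) (simp_all add: F[OF f] F[OF g])
      then show ?thesis
        by (simp add: sum_unfold_sum_mset image_mset.compositionality comp_def)
    qed
    have "(f \<otimes>\<^bsub>group_ring D\<^esub> g) x = (f \<otimes>\<^bsub>group_ring D\<^esub> g) y"
      if "x \<in> carrier D" "y \<in> carrier D" "col x = col y" for x y
    proof -
      have "image_mset (\<lambda>z. (col (x \<otimes> inv z), col z)) (mset_set (carrier D)) =
          image_mset (\<lambda>z. (col (y \<otimes> inv z), col z)) (mset_set (carrier D))"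
        using col that unfolding schur_colouring_def by blast
      then show ?thesis by (simp only: prod[OF that(1)] prod[OF that(2)])
    qed
    moreover have "(f \<otimes>\<^bsub>group_ring D\<^esub> g) x = 0" if "x \<notin> carrier D" for x
      using that by (auto simp: group_ring_def intro!: sum.neutral)
    ultimately show ?thesis by (rule memI[rotated])
  qed
  moreover have "inv\<^bsub>add_monoid (group_ring D)\<^esub> f \<in> ?A" if "f \<in> ?A" for f
  proof -
    have "inv\<^bsub>add_monoid (group_ring D)\<^esub> f = (\<lambda>x. - f x)"
      using a_inv_group_ring sub that by blast
    moreover have "(\<lambda>x. - f x) \<in> ?A"
    proof (rule memI)
      fix u v assume uv: "u \<in> carrier D" "v \<in> carrier D" "col u = col v"
      show "- f u = - f v" using const[OF that uv] by simp
    qed (use zero[OF that] in simp)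
    ultimately show ?thesis by simp
  qed
  moreover have add_closed: "(\<lambda>x. f x + g x) \<in> ?A" if f: "f \<in> ?A" and g: "g \<in> ?A" for f g
  proof (rule memI)
    fix u assume "u \<notin> carrier D"
    then show "f u + g u = 0" using zero[OF f] zero[OF g] by simp
  next
    fix u v assume uv: "u \<in> carrier D" "v \<in> carrier D" "col u = col v"
    show "f u + g u = f v + g v" using const[OF f uv] const[OF g uv] by simp
  qed
  moreover have zero_closed: "(\<lambda>x. 0) \<in> ?A" by (simp add: A)
  ultimately have "subring ?A (group_ring D)"
    using sub add_closed zero_closed by unfold_locales (auto simp: group_ring_def)
  moreover have "\<exists>S. basic_partition D ?A S"
    using basic_partition_fibres[OF D(1) col] by blast
  ultimately show ?thesis by (simp add: s_ring_def)
qed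

text \<open>By uniqueness of the basic partition, the orbits of the point stabilizer are the colour
  classes. Right translations then upgrade preservation of colours to preservation of the colours of
  all quotients.\<close>

lemma schurian_fibres_transitive:
  fixes D (structure)
  assumes D: "group D" "finite (carrier D)" and col: "schur_colouring D col"
    and sch: "schurian D (int_span (fibres D col))"
    and x: "x \<in> carrier D" and y: "y \<in> carrier D" and xy: "col x = col y"
  obtains f where "f \<in> carrier D \<rightarrow> carrier D" "f \<one>\<^bsub>D\<^esub> = \<one>\<^bsub>D\<^esub>" "f x = y"
    "\<And>u v. u \<in> carrier D \<Longrightarrow> v \<in> carrier D \<Longrightarrow>
      col (f u \<otimes>\<^bsub>D\<^esub> inv\<^bsub>D\<^esub> (f v)) = col (u \<otimes>\<^bsub>D\<^esub> inv\<^bsub>D\<^esub> v)"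
proof -
  interpret group D by fact
  obtain G where G: "subgroup G (BijGroup (carrier D))"
      "right_translation D ` carrier D \<subseteq> G"
      "basic_partition D (int_span (fibres D col))
        (perm_orbits (carrier D) (point_stabilizer (carrier D) G \<one>))"
    using sch by (auto simp: schurian_def)
  let ?P = "point_stabilizer (carrier D) G \<one>"
  have orb: "perm_orbits (carrier D) ?P = fibres D col"
    by (rule basic_partition_unique[OF D(2) G(3) basic_partition_fibres[OF D(1) col]])
  have P: "?P = {g \<in> G. g \<one> = \<one>}"
    by (simp add: point_stabilizer_def stabilizer_def perm_group_def)
  have orbits: "perm_orbits (carrier D) ?P = {{g x |g. g \<in> ?P} |x. x \<in> carrier D}"
    by (simp add: perm_orbits_def orbits_def orbit_def perm_group_def)
  have GB: "g \<in> Bij (carrier D)" if "g \<in> G" for g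
    using subgroup.subset[OF G(1)] that by (auto simp: BijGroup_def)
  have Gmaps: "g u \<in> carrier D" if "g \<in> G" "u \<in> carrier D" for g u
    using Bij_imp_funcset[OF GB[OF that(1)]] that(2) by blast
  have comp: "compose (carrier D) g h \<in> G" if "g \<in> G" "h \<in> G" for g h
    using subgroup.m_closed[OF G(1) that] GB that by (simp add: BijGroup_def)
  have idP: "(\<lambda>x\<in>carrier D. x) \<in> ?P"
    using subgroup.one_closed[OF G(1)] by (simp add: P BijGroup_def)
  have colP: "col (g u) = col u" if "g \<in> ?P" "u \<in> carrier D" for g u
  proof -
    have "{g u |g. g \<in> ?P} \<in> fibres D col" using that orb orbits by blast
    then obtain w where w: "{g u |g. g \<in> ?P} = {y \<in> carrier D. col y = col w}"
      by (auto simp: fibres_def)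
    moreover have "u \<in> {g u |g. g \<in> ?P}"
      using idP that(2) by (intro CollectI exI[of _ "\<lambda>x\<in>carrier D. x"]) simp
    moreover have "g u \<in> {g u |g. g \<in> ?P}" using that by blast
    ultimately show ?thesis unfolding w by simp
  qed
  have "{g x |g. g \<in> ?P} \<in> fibres D col" using x orb orbits by blast
  then obtain w where w: "{g x |g. g \<in> ?P} = {y \<in> carrier D. col y = col w}"
    by (auto simp: fibres_def)
  have "x \<in> {g x |g. g \<in> ?P}"
    using idP x by (intro CollectI exI[of _ "\<lambda>x\<in>carrier D. x"]) simp
  then have "y \<in> {g x |g. g \<in> ?P}" unfolding w using y xy by simp
  then obtain g where g: "g \<in> ?P" "g x = y" by blast
  then have gG: "g \<in> G" "g \<one> = \<one>" by (auto simp: P)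
  have tr: "right_translation D w \<in> G" if "w \<in> carrier D" for w
    using G(2) that by blast
  have "col (g u \<otimes> inv (g v)) = col (u \<otimes> inv v)" if u: "u \<in> carrier D" and v: "v \<in> carrier D" for u v
  proof -
    \<comment> \<open>\<open>?h\<close> sends \<open>w\<close> to \<open>g (w v)\<close> divided by
      \<open>g v\<close>; it fixes the identity and maps the quotient of \<open>u\<close> by
      \<open>v\<close> to that of \<open>g u\<close> by \<open>g v\<close>.\<close>
    let ?h = "compose (carrier D) (right_translation D (inv (g v)))
      (compose (carrier D) g (right_translation D v))"
    have gv: "g v \<in> carrier D" using Gmaps gG v by blast
    have "?h \<in> G" using comp tr gG v gv by simp
    moreover have h: "?h w = g (w \<otimes> v) \<otimes> inv (g v)" if "w \<in> carrier D" for w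
      using that v gv Gmaps gG by (simp add: compose_def right_translation_def)
    ultimately have "?h \<in> ?P" using v gv by (simp add: P)
    from colP[OF this, of "u \<otimes> inv v"] show ?thesis
      using h[of "u \<otimes> inv v"] u v by (simp add: m_assoc)
  qed
  then show ?thesis
    using that[of g] g gG Gmaps by blast
qed

text \<open>Reduces the claim to calculations in a set \<open>C\<close> of coordinates: schurity of
  the transported colouring would yield exactly a map excluded by \<open>no_map\<close>.\<close>

lemma not_schur_group_if_coordinates:
  fixes D (structure) and \<phi> :: "'b \<Rightarrow> 'a" and col :: "'b \<Rightarrow> 'c"
  assumes D: "group D" "finite (carrier D)"
    and \<phi>: "bij_betw \<phi> C (carrier D)" and e: "e \<in> C" "\<phi> e = \<one>\<^bsub>D\<^esub>"
    and dv: "\<And>x y. x \<in> C \<Longrightarrow> y \<in> C \<Longrightarrow> dv x y \<in> C \<and> \<phi> x \<otimes>\<^bsub>D\<^esub> inv\<^bsub>D\<^esub> (\<phi> y) = \<phi> (dv x y)"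
    and one: "\<And>x. x \<in> C \<Longrightarrow> col x = col e \<Longrightarrow> x = e"
    and inverse: "\<And>x y. x \<in> C \<Longrightarrow> y \<in> C \<Longrightarrow> col x = col y \<Longrightarrow> col (dv e x) = col (dv e y)"
    and count: "\<And>x y. x \<in> C \<Longrightarrow> y \<in> C \<Longrightarrow> col x = col y \<Longrightarrow>
      image_mset (\<lambda>z. (col (dv x z), col z)) (mset_set C) =
      image_mset (\<lambda>z. (col (dv y z), col z)) (mset_set C)"
    and p: "p \<in> C" "q \<in> C" "col p = col q"
    and no_map: "\<And>f. f \<in> C \<rightarrow> C \<Longrightarrow> f e = e \<Longrightarrow> f p = q \<Longrightarrow>
      (\<And>u v. u \<in> C \<Longrightarrow> v \<in> C \<Longrightarrow> col (dv (f u) (f v)) = col (dv u v)) \<Longrightarrow> False"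
  shows "\<not> schur_group D"
proof
  assume schur: "schur_group D"
  interpret group D by fact
  define \<psi> where "\<psi> = the_inv_into C \<phi>"
  have \<phi>C: "\<phi> x \<in> carrier D" if "x \<in> C" for x
    using \<phi> that by (auto simp: bij_betw_def)
  have \<psi>C: "\<psi> x \<in> C" and \<phi>\<psi>: "\<phi> (\<psi> x) = x" if "x \<in> carrier D" for x
    using \<phi> that by (auto simp: \<psi>_def bij_betw_def the_inv_into_into f_the_inv_into_f)
  have \<psi>\<phi>: "\<psi> (\<phi> x) = x" if "x \<in> C" for x
    using \<phi> that by (simp add: \<psi>_def bij_betw_def the_inv_into_f_f)
  have \<psi>e: "\<psi> \<one> = e" using \<psi>\<phi> e by metis
  have \<psi>dv: "\<psi> (x \<otimes> inv y) = dv (\<psi> x) (\<psi> y)" if "x \<in> carrier D" "y \<in> carrier D" for x y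
    using dv[OF \<psi>C \<psi>C, OF that] \<phi>\<psi> that \<psi>\<phi> by simp
  have \<psi>inv: "\<psi> (inv x) = dv e (\<psi> x)" if "x \<in> carrier D" for x
    using \<psi>dv[OF one_closed that] that by (simp add: \<psi>e)
  let ?col = "col \<circ> \<psi>"
  have ms: "image_mset (\<lambda>z. (?col (x \<otimes> inv z), ?col z)) (mset_set (carrier D)) =
      image_mset (\<lambda>z. (col (dv (\<psi> x) z), col z)) (mset_set C)" if "x \<in> carrier D" for x
  proof -
    have "mset_set (carrier D) = image_mset \<phi> (mset_set C)"
      using \<phi> by (simp add: bij_betw_def image_mset_mset_set)
    moreover have "(?col (x \<otimes> inv (\<phi> z)), ?col (\<phi> z)) = (col (dv (\<psi> x) z), col z)" if "z \<in> C" for z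
      using that \<open>x \<in> carrier D\<close> by (simp add: \<psi>dv \<psi>\<phi> \<phi>C)
    ultimately show ?thesis
      using bij_betw_finite[OF \<phi>] D(2)
      by (auto simp: image_mset.compositionality comp_def intro!: image_mset_cong)
  qed
  have "schur_colouring D ?col"
    unfolding schur_colouring_def
  proof (intro conjI ballI impI)
    fix x assume x: "x \<in> carrier D" "?col x = ?col \<one>"
    then have "\<psi> x = e" using one[OF \<psi>C] by (simp add: \<psi>e)
    then show "x = \<one>" using \<phi>\<psi> x e by metis
  next
    fix x y assume x: "x \<in> carrier D" "y \<in> carrier D" "?col x = ?col y"
    then show "?col (inv x) = ?col (inv y)"
      using inverse[OF \<psi>C \<psi>C, of x y] by (simp add: \<psi>inv)
    show "image_mset (\<lambda>z. (?col (x \<otimes> inv z), ?col z)) (mset_set (carrier D)) =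
        image_mset (\<lambda>z. (?col (y \<otimes> inv z), ?col z)) (mset_set (carrier D))"
      unfolding ms[OF x(1)] ms[OF x(2)] using x by (intro count) (auto simp: \<psi>C)
  qed
  note col = this
  have sch: "schurian D (int_span (fibres D ?col))"
    using schur s_ring_fibres[OF D col] by (simp add: schur_group_def)
  obtain g where g: "g \<in> carrier D \<rightarrow> carrier D" "g \<one> = \<one>" "g (\<phi> p) = \<phi> q"
    "\<And>u v. u \<in> carrier D \<Longrightarrow> v \<in> carrier D \<Longrightarrow> ?col (g u \<otimes> inv (g v)) = ?col (u \<otimes> inv v)"
    using schurian_fibres_transitive[OF D col sch \<phi>C[OF p(1)] \<phi>C[OF p(2)]] p
    by (auto simp: \<psi>\<phi>)
  show False
  proof (rule no_map[of "\<lambda>u. \<psi> (g (\<phi> u))"])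
    have g_mem: "g (\<phi> u) \<in> carrier D" if "u \<in> C" for u using that g(1) \<phi>C by blast
    then show "(\<lambda>u. \<psi> (g (\<phi> u))) \<in> C \<rightarrow> C" using \<psi>C by auto
    show "\<psi> (g (\<phi> e)) = e" "\<psi> (g (\<phi> p)) = q" using g e p \<psi>e \<psi>\<phi> by auto
    fix u v assume "u \<in> C" "v \<in> C"
    then show "col (dv (\<psi> (g (\<phi> u))) (\<psi> (g (\<phi> v)))) = col (dv u v)"
      using g(4)[of "\<phi> u" "\<phi> v"] by (simp add: \<psi>dv g_mem \<phi>C \<psi>\<phi>)
  qed
qed

section \<open>Coordinates\<close>

type_synonym coord = "nat \<times> bool \<times> bool"

text \<open>The triple \<open>(r, p, q)\<close> stands for \<open>a ^ (r + m p) b ^ q\<close>, and \<open>coord_div m x y\<close> for \<open>x y\<^sup>-\<^sup>1\<close>;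
  the inequation of truth values serves as addition modulo 2.\<close>

definition coords :: "nat \<Rightarrow> coord set" where
  "coords m = {..<m} \<times> UNIV"

fun coord_div :: "nat \<Rightarrow> coord \<Rightarrow> coord \<Rightarrow> coord" where
  "coord_div m (r, p, q) (s, p', q') =
    (if s \<le> r then r - s else r + m - s,
     ((p \<noteq> p') \<noteq> ((q \<noteq> q') \<and> odd s)) \<noteq> (r < s), q \<noteq> q')"

lemma coord_div_in_coords: "x \<in> coords m \<Longrightarrow> y \<in> coords m \<Longrightarrow> coord_div m x y \<in> coords m"
  by (cases x; cases y) (auto simp: coords_def)

lemma two_power_pred: "n \<ge> 3 \<Longrightarrow> (2::nat) ^ (n - Suc 0) = 2 * 2 ^ (n - 2)"
  by (simp flip: power_Suc add: Suc_diff_le Suc_diff_Suc numeral_2_eq_2)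

section \<open>Powers of generators, and an action of words that separates the coordinates\<close>

lemma word_class_gpow:
  "word_class R (gpow g k) = word_class R [(g, True)] [^]\<^bsub>presented_group R\<^esub> k"
proof (induction k)
  case 0
  show ?case by (simp add: presented_group_one[symmetric] nat_pow_def)
next
  case (Suc k)
  then show ?case
    using presented_group_mult[of R "gpow g k" "[(g, True)]"]
    by (simp add: nat_pow_def replicate_append_same)
qed

text \<open>Left multiplication on the normal forms \<open>a ^ i b ^ j\<close>; it separates group elements with
  different coordinates.\<close>

fun word_act :: "nat \<Rightarrow> gen \<times> bool \<Rightarrow> nat \<times> bool \<Rightarrow> nat \<times> bool" where
  "word_act m (GenA, True) (i, j) = ((i + 1) mod (2 * m), j)"
| "word_act m (GenA, False) (i, j) = ((i + (2 * m - 1)) mod (2 * m), j)"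
| "word_act m (GenB, _) (i, j) = ((i + m * i) mod (2 * m), \<not> j)"

lemma word_act_gpow_GenA:
  "i < 2 * m \<Longrightarrow> foldr (word_act m) (gpow GenA k) (i, j) = ((i + k) mod (2 * m), j)"
  by (induction k) (auto simp: mod_Suc_eq)

text \<open>The generator b multiplies exponents by \<open>1 + m\<close> modulo
  \<open>2 * m\<close>, an involution because \<open>m\<close> is even. \<open>c = 0\<close> yields
  the relation for b^2, \<open>c = 1\<close> the one for b a b.\<close>

lemma twist_twist_mod:
  fixes m i :: nat
  assumes "even m"
  shows "((i + m * i) mod (2 * m) + c + m * ((i + m * i) mod (2 * m) + c)) mod (2 * m) =
    (i + c + m * c) mod (2 * m)"
proof -
  obtain h where h: "m = 2 * h" using assms by blast
  have "((i + m * i) mod (2 * m) + c + m * ((i + m * i) mod (2 * m) + c)) mod (2 * m)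
      = ((1 + m) * ((i + m * i) mod (2 * m) + c)) mod (2 * m)"
    by (simp add: algebra_simps)
  also have "\<dots> = ((1 + m) * ((i + m * i) + c)) mod (2 * m)"
    by (rule mod_mult_cong[OF refl mod_add_left_eq])
  also have "(1 + m) * ((i + m * i) + c) = i + c + m * c + 2 * m * (i + h * i)"
    unfolding h by (simp add: algebra_simps)
  finally show ?thesis by simp
qed

text \<open>The relations hold for the action on exponents modulo \<open>2 * m\<close>. The bound on
  \<open>x\<close> matters: the empty word does not reduce an exponent.\<close>

lemma word_cong_imp_foldr_word_act_eq:
  assumes n: "n \<ge> 3" and m: "m = 2 ^ (n - 2)"
    and uv: "word_cong (modular_relations n) u v" and x: "x \<in> {..<2 * m} \<times> UNIV"
  shows "foldr (word_act m) u x = foldr (word_act m) v x"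
  using uv x
proof (induction arbitrary: x)
  case (wc_append u u' v v')
  have "foldr (word_act m) w y \<in> {..<2 * m} \<times> UNIV" if "y \<in> {..<2 * m} \<times> UNIV" for w y
  proof (induction w)
    case (Cons l w)
    obtain g s where "l = (g, s)" by (cases l)
    then show ?case
      using m by (cases g; cases s; cases "foldr (word_act m) w y") auto
  qed (use that in simp)
  then show ?case using wc_append by simp
next
  case (wc_cancel g s)
  have even: "even m" using n m by simp
  obtain i j where x: "x = (i, j)" "i < 2 * m" using wc_cancel by auto
  have "((i + 1) mod (2 * m) + (2 * m - 1)) mod (2 * m) = i"
    "((i + (2 * m - 1)) mod (2 * m) + 1) mod (2 * m) = i"
    unfolding mod_add_left_eq using x(2) by simp_all
  then show ?case
    using x twist_twist_mod[OF even, of i 0]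
    by (cases g; cases s) simp_all
next
  case (wc_rel u v)
  have even: "even m" using n m by simp
  have N: "2 ^ (n - Suc 0) = 2 * m"
    using two_power_pred[OF n] by (simp add: m)
  obtain i j where x: "x = (i, j)" "i < 2 * m" using wc_rel by auto
  consider "u = gpow GenA (2 * m)" "v = []" | "u = gpow GenB 2" "v = []"
    | "u = [(GenB, True), (GenA, True), (GenB, True)]" "v = gpow GenA (1 + m)"
    using wc_rel(1) n by (auto simp: modular_relations_def N m[symmetric])
  then show ?case
  proof cases
    case 1
    then show ?thesis using x word_act_gpow_GenA[OF x(2), of "2 * m" j] by simp
  next
    case 2
    then show ?thesis using x twist_twist_mod[OF even, of i 0]
      by (simp add: numeral_2_eq_2)
  next
    case 3
    show ?thesis
    proof -
      let ?i = "(i + m * i) mod (2 * m)"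
      have "foldr (word_act m) u x = (((?i + 1) mod (2 * m) + m * ((?i + 1) mod (2 * m))) mod (2 * m), j)"
        using x 3 by simp
      also have "((?i + 1) mod (2 * m) + m * ((?i + 1) mod (2 * m))) mod (2 * m)
          = (?i + 1 + m * (?i + 1)) mod (2 * m)"
        by (rule mod_add_cong) (simp_all add: mod_mult_right_eq)
      also have "\<dots> = (i + (1 + m)) mod (2 * m)"
        using twist_twist_mod[OF even, of i 1] by (simp add: add.assoc)
      finally show ?thesis
        using word_act_gpow_GenA[OF x(2), of "1 + m" j] 3 x by simp
    qed
  qed
qed auto

definition of_coord :: "nat \<Rightarrow> coord \<Rightarrow> gen gword set" where
  "of_coord n x = (case x of (r, p, q) \<Rightarrow>
    word_class (modular_relations n) (gpow GenA (r + 2 ^ (n - 2) * of_bool p) @ gpow GenB (of_bool q)))"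

text \<open>Acting on \<open>(0, False)\<close>, a normal form returns its own exponents.\<close>

lemma inj_on_of_coord:
  assumes n: "n \<ge> 3"
  shows "inj_on (of_coord n) (coords (2 ^ (n - 2)))"
proof (rule inj_onI)
  fix x y assume xy: "x \<in> coords (2 ^ (n - 2))" "y \<in> coords (2 ^ (n - 2))" "of_coord n x = of_coord n y"
  define m :: nat where "m = 2 ^ (n - 2)"
  obtain r p q s p' q' where x: "x = (r, p, q)" "y = (s, p', q')" by (cases x; cases y)
  have rs: "r < m" "s < m" using xy by (auto simp: x m_def coords_def)
  have *: "foldr (word_act m) (gpow GenA i @ gpow GenB (of_bool b)) (0, False) = (i, b)"
    if "i < 2 * m" for i b
    using that word_act_gpow_GenA[of 0 m] by (cases b) auto
  have "word_cong (modular_relations n) (gpow GenA (r + m * of_bool p) @ gpow GenB (of_bool q))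
     (gpow GenA (s + m * of_bool p') @ gpow GenB (of_bool q'))"
    using xy by (simp add: x of_coord_def m_def word_class_eq_iff)
  from word_cong_imp_foldr_word_act_eq[OF n m_def this, of "(0, False)"]
  have "(r + m * of_bool p, q) = (s + m * of_bool p', q')"
    using rs *[of "r + m * of_bool p" q] *[of "s + m * of_bool p'" q']
    by (simp add: m_def of_bool_def split: if_splits del: foldr_append)
  then show "x = y" using rs by (auto simp: x of_bool_def split: if_splits)
qed

text \<open>It suffices that \<open>coord_div m x y\<close> times \<open>y\<close> is
  \<open>x\<close>. Moving b past a^v adds \<open>m * v\<close> to the exponent; modulo
  \<open>2 * m\<close> only the parity of v counts, whence \<open>odd s\<close>.\<close>

lemma of_coord_coord_div:
  assumes n: "n \<ge> 3" and x: "x \<in> coords (2 ^ (n - 2))" and y: "y \<in> coords (2 ^ (n - 2))"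
  shows "of_coord n x \<otimes>\<^bsub>modular_group n\<^esub> inv\<^bsub>modular_group n\<^esub> of_coord n y =
    of_coord n (coord_div (2 ^ (n - 2)) x y)"
proof -
  define m :: nat where "m = 2 ^ (n - 2)"
  define G where "G = modular_group n"
  define a where "a = word_class (modular_relations n) [(GenA, True)]"
  define b where "b = word_class (modular_relations n) [(GenB, True)]"
  interpret group G unfolding G_def by (rule group_modular_group)
  have G: "G = presented_group (modular_relations n)" by (simp add: G_def modular_group_def)
  have ab: "a \<in> carrier G" "b \<in> carrier G"
    by (auto simp: G a_def b_def presented_group_carrier)
  have coord: "of_coord n (r, p, q) = a [^]\<^bsub>G\<^esub> (r + m * of_bool p) \<otimes>\<^bsub>G\<^esub> b [^]\<^bsub>G\<^esub> (of_bool q :: nat)" for r p q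
    by (simp add: of_coord_def G a_def b_def m_def word_class_gpow[symmetric] presented_group_mult)
  have N: "2 ^ (n - Suc 0) = 2 * m"
    using two_power_pred[OF n] by (simp add: m_def)
  have rel: "word_class (modular_relations n) u = word_class (modular_relations n) v"
    if "(u, v) \<in> modular_relations n" for u v
    using that by (simp add: word_class_eq_iff wc_rel)
  have aN: "a [^]\<^bsub>G\<^esub> (2 * m) = \<one>\<^bsub>G\<^esub>"
    using rel[of "gpow GenA (2 * m)" "[]"]
    by (simp add: modular_relations_def N G a_def word_class_gpow[symmetric] presented_group_one)
  have bb: "b \<otimes>\<^bsub>G\<^esub> b = \<one>\<^bsub>G\<^esub>"
    using rel[of "gpow GenB 2" "[]"]
    by (simp add: modular_relations_def G b_def presented_group_mult presented_group_one numeral_2_eq_2)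
  have bab: "b \<otimes>\<^bsub>G\<^esub> a \<otimes>\<^bsub>G\<^esub> b = a [^]\<^bsub>G\<^esub> (1 + m)"
  proof -
    have "word_class (modular_relations n) [(GenB, True), (GenA, True), (GenB, True)] =
        word_class (modular_relations n) (gpow GenA (1 + m))"
      by (rule rel) (simp add: modular_relations_def m_def)
    then show ?thesis
      unfolding word_class_gpow by (simp only: G a_def b_def presented_group_mult append.simps)
  qed
  have ba: "b \<otimes>\<^bsub>G\<^esub> a = a [^]\<^bsub>G\<^esub> (1 + m) \<otimes>\<^bsub>G\<^esub> b"
    using bb ab unfolding bab[symmetric] by (simp add: m_assoc)
  have bai: "b \<otimes>\<^bsub>G\<^esub> a [^]\<^bsub>G\<^esub> i = a [^]\<^bsub>G\<^esub> ((1 + m) * i) \<otimes>\<^bsub>G\<^esub> b" for i :: nat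
  proof (induction i)
    case 0
    show ?case using ab by simp
  next
    case (Suc i)
    have "b \<otimes>\<^bsub>G\<^esub> a [^]\<^bsub>G\<^esub> Suc i = (b \<otimes>\<^bsub>G\<^esub> a [^]\<^bsub>G\<^esub> i) \<otimes>\<^bsub>G\<^esub> a"
      using ab by (simp add: m_assoc)
    also have "\<dots> = a [^]\<^bsub>G\<^esub> ((1 + m) * i) \<otimes>\<^bsub>G\<^esub> (b \<otimes>\<^bsub>G\<^esub> a)"
      using ab by (simp only: Suc.IH) (simp add: m_assoc)
    also have "\<dots> = a [^]\<^bsub>G\<^esub> ((1 + m) * Suc i) \<otimes>\<^bsub>G\<^esub> b"
      unfolding ba using ab by (simp add: m_assoc[symmetric] nat_pow_mult add.commute del: nat_pow_Suc)
    finally show ?case .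
  qed
  have a_add: "a [^]\<^bsub>G\<^esub> (i + 2 * m * w) = a [^]\<^bsub>G\<^esub> i" for i w
    using ab aN by (simp add: nat_pow_mult[symmetric] nat_pow_pow[symmetric])
  obtain r p q s p' q' where xy: "x = (r, p, q)" "y = (s, p', q')" by (cases x; cases y)
  have rs: "r < m" "s < m" using x y by (auto simp: xy m_def coords_def)
  define t where "t = (if s \<le> r then r - s else r + m - s)"
  define c where "c = (((p \<noteq> p') \<noteq> ((q \<noteq> q') \<and> odd s)) \<noteq> (r < s))"
  define z :: nat where "z = of_bool (q \<noteq> q')"
  have div: "coord_div m x y = (t, c, q \<noteq> q')" by (simp add: xy t_def c_def)
  have "even m" using n by (simp add: m_def)
  then obtain h where h: "m = 2 * h" by blast
  define u where "u = s div 2"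
  have u: "s = 2 * u + of_bool (odd s)" by (simp add: u_def of_bool_odd_eq_mod_2)
  have ts: "t + s = r + m * of_bool (r < s)" using rs by (auto simp: t_def)
  \<comment> \<open>Coefficients of \<open>m\<close> modulo 2: \<open>of_bool (r < s)\<close> is the
    carry in \<open>t + s\<close>, and \<open>c\<close> is chosen to make the parities agree. The
    inequality guards against truncated subtraction.\<close>
  obtain w where w: "of_bool (r < s) + of_bool c + of_bool p' + z * of_bool (odd s) = of_bool p + 2 * w"
  proof -
    have "even (of_bool (r < s) + of_bool c + of_bool p' + z * of_bool (odd s) - of_bool p :: nat)
      \<and> of_bool p \<le> (of_bool (r < s) + of_bool c + of_bool p' + z * of_bool (odd s) :: nat)"
      by (auto simp: c_def z_def)
    then show ?thesis using that by (metis dvdE le_add_diff_inverse)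
  qed
  \<comment> \<open>Writing \<open>s\<close> as \<open>2 * u\<close> plus its parity and
    \<open>m\<close> as \<open>2 * h\<close> extracts the multiples of \<open>2 * m\<close> from the
    twist.\<close>
  have "t + m * of_bool c + (s + m * of_bool p') + z * m * (s + m * of_bool p')
      = (t + s) + m * (of_bool c + of_bool p' + z * of_bool (odd s)) + 2 * m * (z * u + z * h * of_bool p')"
    by (subst (2) u, subst (3) h) (simp add: algebra_simps)
  also have "\<dots> = r + m * of_bool p + 2 * m * (w + z * u + z * h * of_bool p')"
    unfolding ts using arg_cong[OF w, of "(*) m"] by (simp add: algebra_simps)
  finally have exp: "t + m * of_bool c + (s + m * of_bool p') + z * m * (s + m * of_bool p') = \<dots>" .
  let ?v = "s + m * of_bool p'"
  have bz: "b [^]\<^bsub>G\<^esub> z \<otimes>\<^bsub>G\<^esub> a [^]\<^bsub>G\<^esub> ?v = a [^]\<^bsub>G\<^esub> (?v + z * m * ?v) \<otimes>\<^bsub>G\<^esub> b [^]\<^bsub>G\<^esub> z"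
    using ab bai[of ?v] by (cases "q \<noteq> q'") (simp_all add: z_def)
  have "of_coord n (coord_div m x y) \<otimes>\<^bsub>G\<^esub> of_coord n y =
    a [^]\<^bsub>G\<^esub> (t + m * of_bool c) \<otimes>\<^bsub>G\<^esub> (b [^]\<^bsub>G\<^esub> z \<otimes>\<^bsub>G\<^esub> a [^]\<^bsub>G\<^esub> ?v) \<otimes>\<^bsub>G\<^esub> b [^]\<^bsub>G\<^esub> (of_bool q' :: nat)"
    unfolding div unfolding xy(2) coord z_def[symmetric] using ab by (simp only: m_assoc nat_pow_closed m_closed)
  also have "\<dots> = a [^]\<^bsub>G\<^esub> (t + m * of_bool c + ?v + z * m * ?v) \<otimes>\<^bsub>G\<^esub> (b [^]\<^bsub>G\<^esub> z \<otimes>\<^bsub>G\<^esub> b [^]\<^bsub>G\<^esub> (of_bool q' :: nat))"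
    unfolding bz using ab by (simp add: m_assoc nat_pow_mult[symmetric])
  also have "b [^]\<^bsub>G\<^esub> z \<otimes>\<^bsub>G\<^esub> b [^]\<^bsub>G\<^esub> (of_bool q' :: nat) = b [^]\<^bsub>G\<^esub> (of_bool q :: nat)"
    using ab bb by (cases q; cases q') (simp_all add: z_def)
  also have "a [^]\<^bsub>G\<^esub> (t + m * of_bool c + ?v + z * m * ?v) \<otimes>\<^bsub>G\<^esub> b [^]\<^bsub>G\<^esub> (of_bool q :: nat) = of_coord n x"
    unfolding exp a_add xy coord ..
  finally have "of_coord n (coord_div m x y) \<otimes>\<^bsub>G\<^esub> of_coord n y = of_coord n x" .
  moreover have "of_coord n w \<in> carrier G" for w
    by (cases w) (auto simp: coord ab)
  ultimately show ?thesis
    unfolding m_def[symmetric] G_def[symmetric] by (metis inv_solve_right)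
qed

lemma of_coord_image:
  assumes n: "n \<ge> 3"
  shows "of_coord n ` coords (2 ^ (n - 2)) = carrier (modular_group n)"
proof
  show "of_coord n ` coords (2 ^ (n - 2)) \<subseteq> carrier (modular_group n)"
    by (auto simp: of_coord_def modular_group_def presented_group_carrier split: prod.splits)
  show "carrier (modular_group n) \<subseteq> of_coord n ` coords (2 ^ (n - 2))"
  proof
    fix X assume "X \<in> carrier (modular_group n)"
    then obtain w where X: "X = word_class (modular_relations n) w"
      by (auto simp: modular_group_def presented_group_carrier)
    define m :: nat where "m = 2 ^ (n - 2)"
    have N: "2 ^ (n - Suc 0) = 2 * m"
      using two_power_pred[OF n] by (simp add: m_def)
    obtain i j where ij: "word_cong (modular_relations n) w (gpow GenA i @ gpow GenB j)"
      using modular_normal_form by blast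
    have "word_cong (modular_relations n) (gpow GenA (2 * m)) []" 
      "word_cong (modular_relations n) (gpow GenB 2) []"
      by (auto intro!: wc_rel simp: modular_relations_def N)
    then have "word_cong (modular_relations n) (gpow GenA i @ gpow GenB j)
        (gpow GenA (i mod (2 * m)) @ gpow GenB (j mod 2))"
      by (intro wc_append wc_gpow_mod)
    then have "X = word_class (modular_relations n) (gpow GenA (i mod (2 * m)) @ gpow GenB (j mod 2))"
      unfolding X word_class_eq_iff using ij by (rule wc_trans[rotated])
    moreover have "i mod (2 * m) = i mod m + m * of_bool (m \<le> i mod (2 * m))"
    proof -
      have "i mod (2 * m) < 2 * m" by (simp add: m_def)
      moreover have "i mod m = i mod (2 * m) mod m" by (simp add: mod_mod_cancel)
      ultimately show ?thesis by (auto simp: le_mod_geq)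
    qed
    moreover have "j mod 2 = of_bool (odd j)" by (simp add: mod2_eq_if)
    ultimately have "X = of_coord n (i mod m, m \<le> i mod (2 * m), odd j)"
      by (simp add: of_coord_def m_def)
    then show "X \<in> of_coord n ` coords (2 ^ (n - 2))"
      by (auto simp: coords_def m_def)
  qed
qed

lemma bij_betw_of_coord:
  "n \<ge> 3 \<Longrightarrow> bij_betw (of_coord n) (coords (2 ^ (n - 2))) (carrier (modular_group n))"
  by (simp add: bij_betw_def inj_on_of_coord of_coord_image)

lemma of_coord_one: "of_coord n (0, False, False) = \<one>\<^bsub>modular_group n\<^esub>"
  by (simp add: of_coord_def modular_group_def presented_group_one)

section \<open>Order 16\<close>

type_synonym bits = "bool \<times> bool \<times> bool \<times> bool"

text \<open>Truth values instead of numbers keep the exhaustive checks by \<open>code_simp\<close> fast.\<close>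

fun of_bits :: "bits \<Rightarrow> coord" where
  "of_bits (h, l, p, q) = (2 * of_bool h + of_bool l, p, q)"

text \<open>With \<open>r = 2 h + l\<close>, the borrow from the lower digit is
  \<open>\<not> l \<and> l'\<close>, the parity of the divisor's exponent is \<open>l'\<close>, and
  the \<open>if\<close> decides whether the residue wraps around.\<close>

fun div16 :: "bits \<Rightarrow> bits \<Rightarrow> bits" where
  "div16 (h, l, p, q) (h', l', p', q') =
    ((h \<noteq> h') \<noteq> (\<not> l \<and> l'), l \<noteq> l',
     ((p \<noteq> p') \<noteq> ((q \<noteq> q') \<and> l')) \<noteq> (if h = h' then \<not> l \<and> l' else h'), q \<noteq> q')"

lemma coord_div_of_bits: "coord_div 4 (of_bits x) (of_bits y) = of_bits (div16 x y)"
  by (cases x; cases y) (auto simp: of_bool_def)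

lemma bij_betw_of_bits: "bij_betw of_bits UNIV (coords 4)"
proof -
  have "r = 2 * of_bool (r \<ge> 2) + of_bool (odd r)" if "r < 4" for r :: nat
  proof -
    have "r = 0 \<or> r = 1 \<or> r = 2 \<or> r = 3" using that by arith
    then show ?thesis by auto
  qed
  then have "(r, p, q) = of_bits (r \<ge> 2, odd r, p, q)" if "r < 4" for r p q
    using that by simp
  then have "coords 4 \<subseteq> range of_bits" by (force simp: coords_def simp del: of_bits.simps)
  moreover have "inj of_bits" by (auto simp: inj_def of_bool_def split: if_splits)
  ultimately show ?thesis by (auto simp: bij_betw_def coords_def of_bool_def)
qed

text \<open>The values are mere labels of the six classes; for odd exponents,
  \<open>p = (h \<and> \<not> q)\<close> singles out a, a^7, a b and a^3 b.\<close>

fun col16 :: "bits \<Rightarrow> bool \<times> bool \<times> bool" where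
  "col16 (h, l, p, q) =
    (if l then (True, False, p = (h \<and> \<not> q))
     else if q then (False, True, True)
     else if h then (False, True, False)
     else (False, False, p))"

definition bits_list :: "bits list" where
  "bits_list = [(False, False, False, False), (False, False, False, True),
    (False, False, True, False), (False, False, True, True),
    (False, True, False, False), (False, True, False, True),
    (False, True, True, False), (False, True, True, True),
    (True, False, False, False), (True, False, False, True),
    (True, False, True, False), (True, False, True, True),
    (True, True, False, False), (True, True, False, True),
    (True, True, True, False), (True, True, True, True)]"


section \<open>Exhaustive checks over the 16 elements\<close>

lemma set_bits_list: "set bits_list = UNIV"
proof -
  have "(h, l, p, q) \<in> set bits_list" for h l p q
    by (cases h; cases l; cases p; cases q; simp add: bits_list_def)
  then show ?thesis by auto
qed

lemma mset_bits_list: "mset_set UNIV = mset bits_list"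
proof -
  have "distinct bits_list" by code_simp
  then show ?thesis by (metis mset_set_set set_bits_list)
qed

lemma list_all_bits_list: "list_all P bits_list \<longleftrightarrow> (\<forall>x. P x)"
  by (simp add: list_all_iff set_bits_list)

lemma col16_inverse:
  "col16 x = col16 y \<Longrightarrow>
    col16 (div16 (False, False, False, False) x) = col16 (div16 (False, False, False, False) y)"
proof -
  have "list_all (\<lambda>x. list_all (\<lambda>y. col16 x = col16 y \<longrightarrow>
      col16 (div16 (False, False, False, False) x) = col16 (div16 (False, False, False, False) y))
      bits_list) bits_list"
    by code_simp
  then show "col16 x = col16 y \<Longrightarrow> ?thesis" unfolding list_all_bits_list by blast
qed

lemma col16_count:
  assumes "col16 x = col16 y"
  shows "image_mset (\<lambda>z. (col16 (div16 x z), col16 z)) (mset_set UNIV) =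
    image_mset (\<lambda>z. (col16 (div16 y z), col16 z)) (mset_set UNIV)"
proof -
  have "list_all (\<lambda>x. list_all (\<lambda>y. col16 x = col16 y \<longrightarrow>
      mset (map (\<lambda>z. (col16 (div16 x z), col16 z)) bits_list) =
      mset (map (\<lambda>z. (col16 (div16 y z), col16 z)) bits_list)) bits_list) bits_list"
    by code_simp
  then have "mset (map (\<lambda>z. (col16 (div16 x z), col16 z)) bits_list) =
      mset (map (\<lambda>z. (col16 (div16 y z), col16 z)) bits_list)"
    unfolding list_all_bits_list using assms by blast
  then show ?thesis by (simp only: mset_bits_list mset_map)
qed

text \<open>If b went to a^2 b, the colours of the quotients by 1 and by b would force the images of
  a and a b into {a b, a^3 b}. The quotient of these images would be a power of a, whereas a divided
  by a b is a^4 b, which has the colour of b.\<close>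

lemma col16_rigid:
  assumes "\<And>u v. col16 (div16 (f u) (f v)) = col16 (div16 u v)"
    and "f (False, False, False, False) = (False, False, False, False)"
  shows "f (False, False, False, True) \<noteq> (True, False, False, True)"
proof
  assume "f (False, False, False, True) = (True, False, False, True)"
  \<comment> \<open>The points 1, b, a, a b; the candidates \<open>v\<close> and \<open>w\<close>
    are images of the last two.\<close>
  let ?dom = "[(False, False, False, False), (False, False, False, True),
    (False, True, False, False), (False, True, False, True)]"
  let ?img = "\<lambda>v w. [(False, False, False, False), (True, False, False, True), v, w]"
  have "list_all (\<lambda>v. list_all (\<lambda>w. \<not> list_all2 (\<lambda>x x'. list_all2 (\<lambda>y y'.
      col16 (div16 x' y') = col16 (div16 x y)) ?dom (?img v w)) ?dom (?img v w))
      bits_list) bits_list"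
    by code_simp
  moreover have "list_all2 (\<lambda>x x'. list_all2 (\<lambda>y y'. col16 (div16 x' y') = col16 (div16 x y))
      ?dom (map f ?dom)) ?dom (map f ?dom)"
    unfolding list.map list_all2_Cons list_all2_Nil assms(1) by simp
  ultimately show False
    unfolding list_all_bits_list
    by (simp only: list.map assms(2) \<open>f (False, False, False, True) = _\<close>) 
qed

lemma not_schur_group_modular_group_4: "\<not> schur_group (modular_group 4)"
proof (rule not_schur_group_if_coordinates[where C = UNIV and \<phi> = "of_coord 4 \<circ> of_bits"
      and dv = div16 and col = col16 and e = "(False, False, False, False)"
      and p = "(False, False, False, True)" and q = "(True, False, False, True)"])
  have "of_bits x \<in> coords 4" for x
    using bij_betw_of_bits by (auto simp: bij_betw_def)
  then show "div16 x y \<in> UNIV \<and> (of_coord 4 \<circ> of_bits) x \<otimes>\<^bsub>modular_group 4\<^esub>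
      inv\<^bsub>modular_group 4\<^esub> (of_coord 4 \<circ> of_bits) y = (of_coord 4 \<circ> of_bits) (div16 x y)" for x y
    using of_coord_coord_div[of 4 "of_bits x" "of_bits y"] by (simp add: coord_div_of_bits)
  show "bij_betw (of_coord 4 \<circ> of_bits) UNIV (carrier (modular_group 4))"
    using bij_betw_trans[OF bij_betw_of_bits] bij_betw_of_coord[of 4] by simp
  show "x = (False, False, False, False)" if "col16 x = col16 (False, False, False, False)" for x
    using that by (cases x) (auto split: if_splits)
  show False if "f (False, False, False, False) = (False, False, False, False)"
    "f (False, False, False, True) = (True, False, False, True)"
    "\<And>u v. u \<in> UNIV \<Longrightarrow> v \<in> UNIV \<Longrightarrow> col16 (div16 (f u) (f v)) = col16 (div16 u v)" for f
    using col16_rigid[of f] that by simp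
  show "col16 (div16 (False, False, False, False) x) = col16 (div16 (False, False, False, False) y)"
    if "col16 x = col16 y" for x y
    by (rule col16_inverse[OF that])
  show "image_mset (\<lambda>z. (col16 (div16 x z), col16 z)) (mset_set UNIV) =
      image_mset (\<lambda>z. (col16 (div16 y z), col16 z)) (mset_set UNIV)"
    if "col16 x = col16 y" for x y
    by (rule col16_count[OF that])
qed (simp_all add: group_modular_group finite_modular_group of_coord_one)

section \<open>Order at least 32\<close>

text \<open>\<open>coset_ker M r p q\<close> says that \<open>c ^ p b ^ q\<close> lies in \<open>K r\<close>; here \<open>M = m - 1\<close> represents \<open>- 1\<close>.\<close>

definition coset_ker :: "nat \<Rightarrow> nat \<Rightarrow> bool \<Rightarrow> bool \<Rightarrow> bool" where
  "coset_ker M r p q =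
   (if r = 0 then \<not> p \<and> \<not> q
    else if even r then \<not> q
    else if r = 1 then \<not> p
    else if r = M then p = q
    else True)"

text \<open>With \<open>t = r - s\<close> modulo \<open>m\<close>: conjugated into position, \<open>K r\<close> is contained in the product of \<open>K t\<close>
  and \<open>K s\<close>, which is what makes the structure constants well defined.\<close>

lemma coset_ker_translate:
  assumes m: "3 < M" "odd M"  "r \<le> M" "s \<le> M"
    and d: "coset_ker M r p q"
    and t: "even t \<longleftrightarrow> (even r \<longleftrightarrow> even s)" "t = 0 \<longleftrightarrow> r = s"
     "t = 1 \<longleftrightarrow> r = s + 1 \<or> (r = 0 \<and> s = M)"
     "t = M \<longleftrightarrow> s = r + 1 \<or> (s = 0 \<and> r = M)"
  shows "\<exists>k l. coset_ker M s k l \<and> coset_ker M t ((p \<noteq> k) \<noteq> ((q \<noteq> l) \<and> odd s)) (q \<noteq> l)"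
proof -
  \<comment> \<open>\<open>(k, l)\<close> encodes the factor taken from \<open>K s\<close>; the rest
    must lie in \<open>K t\<close> after conjugation by a^s, which for odd \<open>s\<close>
    exchanges b and c b.\<close>
  let ?P = "\<lambda>k l. coset_ker M s k l \<and> coset_ker M t ((p \<noteq> k) \<noteq> ((q \<noteq> l) \<and> odd s)) (q \<noteq> l)"
  consider "\<not> p" "\<not> q" | "p" "\<not> q" | "\<not> p" "q" | p q by blast
  then have "?P False False \<or> ?P True False \<or> ?P False True \<or> ?P True True"
  proof cases
    case 1
    then have "?P False False" by (simp add: coset_ker_def)
    then show ?thesis by blast
  next
    case 2
    then have r: "r \<noteq> 0" "r \<noteq> 1" "r \<noteq> M" using d m by (auto simp: coset_ker_def split: if_splits)
    \<comment> \<open>The element c lies in \<open>K s\<close> unless \<open>s\<close> is 0, 1 or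
      -1, and then in \<open>K t\<close> unless \<open>t = s\<close>; in that last case it is the
      product of b and c b.\<close>
    consider "s = 0" | "s = 1" "r = 2" | "s = 1" "r \<noteq> 2" | "s = M" "r + 1 = M" | "s = M" "r + 1 \<noteq> M"
      | "s \<noteq> 0" "s \<noteq> 1" "s \<noteq> M" by blast
    then show ?thesis
    proof cases
      case 1
      have "t \<noteq> 0" "t \<noteq> 1" "t \<noteq> M" unfolding t using 1 r m by auto
      then have "?P False False" using 1 2 by (simp add: coset_ker_def)
      then show ?thesis by blast
    next
      case c: 2
      have "t = 1" unfolding t using c by simp
      then have "?P False True" using c 2 by (simp add: coset_ker_def)
      then show ?thesis by blast
    next
      case 3
      have "t \<noteq> 0" "t \<noteq> 1" "t \<noteq> M" unfolding t using 3 r m by auto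
      then have "?P False False" using 3 2 by (simp add: coset_ker_def)
      then show ?thesis by blast
    next
      case 4
      have "t = M" unfolding t using 4 by simp
      then have "?P True True" using 4 2 m by (simp add: coset_ker_def)
      then show ?thesis by blast
    next
      case 5
      have "t \<noteq> 0" "t \<noteq> 1" "t \<noteq> M" unfolding t using 5 r m by auto
      then have "?P False False" using 5 2 m by (simp add: coset_ker_def)
      then show ?thesis by blast
    next
      case 6
      then have "?P True False" using 2 by (simp add: coset_ker_def)
      then show ?thesis by blast
    qed
  next
    case 3
    then have r: "odd r" "r \<noteq> M" using d m by (auto simp: coset_ker_def split: if_splits)
    \<comment> \<open>The element b: for odd \<open>s\<close> it lies in \<open>K s\<close> unless
      \<open>s\<close> is -1, for even \<open>s\<close> in \<open>K t\<close> unless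
      \<open>t\<close> is -1. In the exceptional cases c b is corrected by c from the other
      factor.\<close>
    consider "even s" "t = M" | "even s" "t \<noteq> M" | "s = M" | "odd s" "s \<noteq> M" by blast
    then show ?thesis
    proof cases
      case 1
      then have "s \<noteq> 0" using t(4) r by auto
      then have "?P True False" using 1 3 m by (simp add: coset_ker_def)
      then show ?thesis by blast
    next
      case 2
      then have "odd t" "t \<noteq> 0" using t(1) r by (auto intro: Nat.gr0I)
      then have "?P False False" using 2 3 m by (auto simp: coset_ker_def)
      then show ?thesis by blast
    next
      case c: 3
      then have "even t" "t \<noteq> 0" using t(1,2) r m by auto
      then have "?P True True" using c 3 m by (simp add: coset_ker_def)
      then show ?thesis by blast
    next
      case 4
      then have "?P False True" using 3 by (auto simp: coset_ker_def intro: Nat.gr0I)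
      then show ?thesis by blast
    qed
  next
    case 4
    then have r: "odd r" "r \<noteq> 1" using d m by (auto simp: coset_ker_def split: if_splits)
    \<comment> \<open>The same for c b, with the roles of 1 and -1 exchanged.\<close>
    consider "even s" "t = 1" | "even s" "t \<noteq> 1" | "s = 1" | "odd s" "s \<noteq> 1" by blast
    then show ?thesis
    proof cases
      case 1
      then have "s \<noteq> 0" using t(3) r m by auto
      then have "?P True False" using 1 4 m by (simp add: coset_ker_def)
      then show ?thesis by blast
    next
      case 2
      then have "odd t" "t \<noteq> 0" using t(1) r by (auto intro: Nat.gr0I)
      then have "?P False False" using 2 4 m by (auto simp: coset_ker_def)
      then show ?thesis by blast
    next
      case 3
      then have "even t" "t \<noteq> 0" using t(1,2) r m by auto
      then have "?P False True" using 3 4 m by (simp add: coset_ker_def)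
      then show ?thesis by blast
    next
      case c: 4
      then have "?P True True" using 4 by (auto simp: coset_ker_def intro: Nat.gr0I)
      then show ?thesis by blast
    qed
  qed
  then show ?thesis by blast
qed

text \<open>Keeps \<open>r\<close> and coordinates of E modulo \<open>K r\<close>, padded with
  \<open>False\<close>; \<open>p \<noteq> q\<close> is the coordinate unchanged by multiplication
  with c b.\<close>

fun coset_col :: "nat \<Rightarrow> coord \<Rightarrow> coord" where
  "coset_col m (r, p, q) =
    (if r = 0 then (r, p, q)
     else if even r then (r, False, q)
     else if r = 1 then (r, p, False)
     else if r = m - 1 then (r, p \<noteq> q, False)
     else (r, False, False))"

lemma coset_col_eq_iff:
  "coset_col m (r, p, q) = coset_col m (r', p', q') \<longleftrightarrow>
    r = r' \<and> coset_ker (m - 1) r (p \<noteq> p') (q \<noteq> q')"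
  by (auto simp: coset_ker_def)

lemma finite_coords: "finite (coords m)"
  by (simp add: coords_def)

text \<open>The elements \<open>x\<close> and \<open>y\<close> differ by an element of
  \<open>K r\<close>. For each \<open>s\<close>, a decomposition of it prescribes a shift of a^s E
  by an element of \<open>K s\<close> that compensates the change from \<open>x\<close> to
  \<open>y\<close>.\<close>

lemma coset_col_count:
  assumes m: "8 \<le> m" "even m" and x: "x \<in> coords m" and y: "y \<in> coords m"
    and xy: "coset_col m x = coset_col m y"
  shows "image_mset (\<lambda>z. (coset_col m (coord_div m x z), coset_col m z)) (mset_set (coords m)) =
    image_mset (\<lambda>z. (coset_col m (coord_div m y z), coset_col m z)) (mset_set (coords m))"
proof -
  obtain r p q p' q' where xy': "x = (r, p, q)" "y = (r, p', q')"
    using xy by (cases x; cases y) (simp only: coset_col_eq_iff)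
  have d: "coset_ker (m - 1) r (p \<noteq> p') (q \<noteq> q')"
    using xy by (simp only: xy' coset_col_eq_iff)
  have r: "r < m" using x by (simp add: xy' coords_def)
  let ?t = "\<lambda>s. if s \<le> r then r - s else r + m - s"
  \<comment> \<open>The premise \<open>s < m\<close> stands under the quantifiers so that choice
    gives total functions of \<open>s\<close>.\<close>
  have "\<exists>k l. s < m \<longrightarrow> coset_ker (m - 1) s k l \<and>
      coset_ker (m - 1) (?t s) (((p \<noteq> p') \<noteq> k) \<noteq> (((q \<noteq> q') \<noteq> l) \<and> odd s)) ((q \<noteq> q') \<noteq> l)" for s
  proof (cases "s < m")
    case True
    have "even (?t s) \<longleftrightarrow> (even r \<longleftrightarrow> even s)" "?t s = 0 \<longleftrightarrow> r = s"
      "?t s = 1 \<longleftrightarrow> r = s + 1 \<or> (r = 0 \<and> s = m - 1)"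
      "?t s = m - 1 \<longleftrightarrow> s = r + 1 \<or> (s = 0 \<and> r = m - 1)"
      using m r True by auto
    from coset_ker_translate[OF _ _ _ _ d this] show ?thesis using m r True by simp
  qed simp
  then obtain k l where kl: "\<And>s. s < m \<Longrightarrow> coset_ker (m - 1) s (k s) (l s) \<and>
      coset_ker (m - 1) (?t s) (((p \<noteq> p') \<noteq> k s) \<noteq> (((q \<noteq> q') \<noteq> l s) \<and> odd s)) ((q \<noteq> q') \<noteq> l s)"
    by metis
  define \<tau> :: "coord \<Rightarrow> coord" where "\<tau> = (\<lambda>(s, u, v). (s, u \<noteq> k s, v \<noteq> l s))"
  have "\<tau> (\<tau> z) = z" for z by (cases z) (auto simp: \<tau>_def)
  moreover have "\<tau> z \<in> coords m" if "z \<in> coords m" for z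
    using that by (cases z) (auto simp: \<tau>_def coords_def)
  ultimately have "bij_betw \<tau> (coords m) (coords m)"
    by (intro bij_betwI[of _ _ _ \<tau>]) auto
  then have ms: "mset_set (coords m) = image_mset \<tau> (mset_set (coords m))"
    by (simp add: bij_betw_def image_mset_mset_set)
  have "coset_col m (coord_div m y (\<tau> z)) = coset_col m (coord_div m x z) \<and> coset_col m (\<tau> z) = coset_col m z"
    if "z \<in> coords m" for z
  proof -
    obtain s u v where z: "z = (s, u, v)" by (cases z)
    have s: "s < m" using that by (simp add: z coords_def)
    have bits: "(((p' \<noteq> (u \<noteq> k s)) \<noteq> ((q' \<noteq> (v \<noteq> l s)) \<and> odd s)) \<noteq> (r < s)) \<noteq>
        (((p \<noteq> u) \<noteq> ((q \<noteq> v) \<and> odd s)) \<noteq> (r < s)) \<longleftrightarrow>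
        ((p \<noteq> p') \<noteq> k s) \<noteq> (((q \<noteq> q') \<noteq> l s) \<and> odd s)"
      "(q' \<noteq> (v \<noteq> l s)) \<noteq> (q \<noteq> v) \<longleftrightarrow> (q \<noteq> q') \<noteq> l s"
      "((u \<noteq> k s) \<noteq> u) = k s" "((v \<noteq> l s) \<noteq> v) = l s"
      by argo+
    show ?thesis
      unfolding z \<tau>_def xy' prod.case coord_div.simps coset_col_eq_iff bits
      using kl[OF s] by blast
  qed
  then have "image_mset (\<lambda>z. (coset_col m (coord_div m x z), coset_col m z)) (mset_set (coords m)) =
      image_mset (\<lambda>z. (coset_col m (coord_div m y (\<tau> z)), coset_col m (\<tau> z))) (mset_set (coords m))"
    by (intro image_mset_cong) (simp add: finite_coords)
  also have "\<dots> = image_mset (\<lambda>z. (coset_col m (coord_div m y z), coset_col m z)) (image_mset \<tau> (mset_set (coords m)))"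
    by (simp add: image_mset.compositionality comp_def)
  finally show ?thesis by (simp only: ms[symmetric])
qed

text \<open>Inverting the coset a^r K r requires \<open>K (- r)\<close> to be the conjugate of
  \<open>K r\<close> by a^r. As a swaps b and c b, this pairs \<open>K 1 = {1, b}\<close> with
  \<open>K (- 1) = {1, c b}\<close>.\<close>

lemma coset_col_inverse:
  assumes m: "8 \<le> m" "even m" and x: "x \<in> coords m" and y: "y \<in> coords m"
    and xy: "coset_col m x = coset_col m y"
  shows "coset_col m (coord_div m (0, False, False) x) = coset_col m (coord_div m (0, False, False) y)"
proof -
  obtain r p q p' q' where xy': "x = (r, p, q)" "y = (r, p', q')"
    using xy by (cases x; cases y) (simp only: coset_col_eq_iff)
  have d: "coset_ker (m - 1) r (p \<noteq> p') (q \<noteq> q')"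
    using xy by (simp only: xy' coset_col_eq_iff)
  have r: "r < m" using x by (simp add: xy' coords_def)
  show ?thesis
  proof (cases "r = 0")
    case True
    then show ?thesis using d by (simp add: xy' coset_ker_def)
  next
    case False
    have "even (m - r) \<longleftrightarrow> even r" "m - r \<noteq> 0" "m - r = 1 \<longleftrightarrow> r = m - 1" "m - r = m - 1 \<longleftrightarrow> r = 1" "m - 1 \<noteq> 1"
      using r m False by auto
    then show ?thesis
      using d False unfolding xy' coord_div.simps coset_col_eq_iff by (auto simp: coset_ker_def split: if_splits)
  qed
qed

lemma coset_col_rigid:
  assumes m: "8 \<le> m" "even m" and f: "f \<in> coords m \<rightarrow> coords m" and f0: "f (0, False, False) = (0, False, False)"
    and col: "\<And>u v. u \<in> coords m \<Longrightarrow> v \<in> coords m \<Longrightarrow>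
      coset_col m (coord_div m (f u) (f v)) = coset_col m (coord_div m u v)"
  shows "f (4, False, False) = (4, False, False)"
proof -
  have mem: "(i, False, False) \<in> coords m" if "i < m" for i using that by (simp add: coords_def)
  have step: "coset_col m (coord_div m (f (i, False, False)) (f (j, False, False)))
      = coset_col m (coord_div m (i, False, False) (j, False, False))" if "i < m" "j < m" for i j
    using that by (intro col mem)
  \<comment> \<open>The quotient by the fixed identity has the colour of a^i, which determines
    \<open>i\<close> and, for even \<open>i\<close>, excludes a factor b.\<close>
  have "\<exists>p q. f (i, False, False) = (i, p, q) \<and> (even i \<longrightarrow> \<not> q)" if "i < m" for i
    using step[OF that, of 0] m f0 by (cases "f (i, False, False)") (auto split: if_splits)
  then obtain p q where pq: "\<And>i. i < m \<Longrightarrow> f (i, False, False) = (i, p i, q i) \<and> (even i \<longrightarrow> \<not> q i)"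
    by metis
  \<comment> \<open>Quotients of successive powers must lie in a \<open>K 1\<close>, giving the
    first four equations; a^3 divided by a must lie in a^2 \<open>K 2\<close>, giving the fifth. So
    \<open>p 3\<close> and \<open>q 3\<close> both equal \<open>q 1\<close>, and \<open>p 4\<close>
    vanishes.\<close>
  have *: "\<not> p 1" "p 2 = q 1" "p 3 = p 2" "p 4 = (p 3 \<noteq> q 3)" "q 3 = q 1"
    using step[of 1 0] step[of 2 1] step[of 3 2] step[of 4 3] step[of 3 1] m f0 pq[of 1] pq[of 2] pq[of 3] pq[of 4]
    by (auto split: if_splits)
  then show ?thesis using pq[of 4] m by auto
qed

lemma not_schur_group_modular_group_ge_5:
  assumes n: "n \<ge> 5"
  shows "\<not> schur_group (modular_group n)"
proof -
  define m :: nat where "m = 2 ^ (n - 2)"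
  have m: "8 \<le> m" "even m"
    using power_increasing[of 3 "n - 2" "2::nat"] n by (simp_all add: m_def)
  have n3: "n \<ge> 3" using n by simp
  show ?thesis
  proof (rule not_schur_group_if_coordinates[where C = "coords m" and \<phi> = "of_coord n"
        and dv = "coord_div m" and col = "coset_col m" and e = "(0, False, False)"
        and p = "(4, False, False)" and q = "(4, True, False)"])
    show "bij_betw (of_coord n) (coords m) (carrier (modular_group n))"
      unfolding m_def by (rule bij_betw_of_coord[OF n3])
    show "coord_div m x y \<in> coords m \<and> of_coord n x \<otimes>\<^bsub>modular_group n\<^esub>
        inv\<^bsub>modular_group n\<^esub> of_coord n y = of_coord n (coord_div m x y)"
      if "x \<in> coords m" "y \<in> coords m" for x y
      using that coord_div_in_coords of_coord_coord_div[OF n3, of x y] unfolding m_def by blast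
    show "x = (0, False, False)" if "coset_col m x = coset_col m (0, False, False)" for x
      using that by (cases x) (auto split: if_splits)
    show False if "f \<in> coords m \<rightarrow> coords m" "f (0, False, False) = (0, False, False)"
      "f (4, False, False) = (4, True, False)"
      "\<And>u v. u \<in> coords m \<Longrightarrow> v \<in> coords m \<Longrightarrow>
        coset_col m (coord_div m (f u) (f v)) = coset_col m (coord_div m u v)" for f
      using coset_col_rigid[OF m that(1,2,4)] that(3) by simp
    show "coset_col m (coord_div m (0, False, False) x) = coset_col m (coord_div m (0, False, False) y)"
      if "x \<in> coords m" "y \<in> coords m" "coset_col m x = coset_col m y" for x y
      by (rule coset_col_inverse[OF m that])
    show "image_mset (\<lambda>z. (coset_col m (coord_div m x z), coset_col m z)) (mset_set (coords m)) =
        image_mset (\<lambda>z. (coset_col m (coord_div m y z), coset_col m z)) (mset_set (coords m))"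
      if "x \<in> coords m" "y \<in> coords m" "coset_col m x = coset_col m y" for x y
      by (rule coset_col_count[OF m that])
  qed (use m in \<open>simp_all add: group_modular_group finite_modular_group of_coord_one coords_def\<close>)
qed

theorem theorem11p1:
  fixes n :: nat
  assumes "n \<ge> 4"
  shows "\<not> schur_group (modular_group n)"
proof (cases "n = 4")
  case True
  then show ?thesis using not_schur_group_modular_group_4 by simp
next
  case False
  then show ?thesis using assms not_schur_group_modular_group_ge_5 by simp
qed

end
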